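(* Let $d, \mathbf{d}, M \in \mathbb{N}$, $L, b \in (0,\infty)$, $\alpha \in \mathbb{R}$, $\beta \in (\alpha,\infty)$, $D \subseteq \mathbb{R}^d$, let $(\Omega,\mathcal{F},\mathbb{P})$ be a probability space, let $X_j \colon \Omega \to D$, $j \in \{1,2,\ldots,M\}$, and $Y_j \colon \Omega \to \mathbb{R}$, $j \in \{1,2,\ldots,M\}$, be functions, assume that $(X_j,Y_j)$, $j \in \{1,2,\ldots,M\}$, are i.i.d. random variables, let $f = (f_\theta)_{\theta \in [\alpha,\beta]^{\mathbf{d}}} \colon [\alpha,\beta]^{\mathbf{d}} \to C(D,\mathbb{R})$ be a function, assume for all $\theta,\vartheta \in [\alpha,\beta]^{\mathbf{d}}$, $j \in \{1,2,\ldots,M\}$, $x \in D$ that $|f_\theta(X_j) - Y_j| \leq b$ and $|f_\theta(x) - f_\vartheta(x)| \leq L\|\theta-\vartheta\|_\infty$, let $\mathbf{R} \colon [\alpha,\beta]^{\mathbf{d}} \to [0,\infty)$ satisfy for all $\theta \in [\alpha,\beta]^{\mathbf{d}}$ that $\mathbf{R}(\theta) = \mathbb{E}[|f_\theta(X_1) - Y_1|^2]$, and let $\mathcal{R} \colon [\alpha,\beta]^{\mathbf{d}} \times \Omega \to [0,\infty)$ satisfy for all $\theta \in [\alpha,\beta]^{\mathbf{d}}$, $\omega \in \Omega$ that $$\mathcal{R}(\theta,\omega) = \frac{1}{M}\biggl[\sum_{j=1}^M |f_\theta(X_j(\omega)) - Y_j(\omega)|^2\biggr].$$ Then (i) the function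 $\Omega \ni \omega \mapsto \sup_{\theta \in [\alpha,\beta]^{\mathbf{d}}} |\mathcal{R}(\theta,\omega) - \mathbf{R}(\theta)| \in [0,\infty]$ is $\mathcal{F}$/$\mathcal{B}([0,\infty])$-measurable, and (ii) it holds for all $p \in (0,\infty)$ that $$\begin{aligned} &\Bigl(\mathbb{E}\Bigl[\sup_{\theta \in [\alpha,\beta]^{\mathbf{d}}} |\mathcal{R}(\theta) - \mathbf{R}(\theta)|^p\Bigr]\Bigr)^{1/p} \\ &\leq \inf_{C,\varepsilon \in (0,\infty)} \Biggl[\frac{2(C+1)b^2 \max\{1, [2\sqrt{M} L(\beta-\alpha)(Cb)^{-1}]^\varepsilon\} \sqrt{\max\{1,p,\mathbf{d}/\varepsilon\}}}{\sqrt{M}}\Biggr] \\ &\leq \inf_{C \in (0,\infty)} \Biggl[\frac{2(C+1)b^2 \sqrt{e\max\{1,p,\mathbf{d}\ln(4ML^2(\beta-\alpha)^2(Cb)^{-2})\}}}{\sqrt{M}}\Biggr]. \end{aligned}$$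
   Context: $\mathbb{N} = \{1,2,\ldots\}$; $\|\theta\|_\infty = \max_i |\theta_i|$; $C(D,\mathbb{R})$ is the set of continuous functions $D \to \mathbb{R}$; $\mathcal{B}(\cdot)$ denotes the Borel $\sigma$-algebra. $\mathcal{R}(\theta)$ denotes the random variable $\omega \mapsto \mathcal{R}(\theta,\omega)$. *)

theory Defs
  imports "HOL-Probability.Probability"
begin

abbreviation param_cube :: "real \<Rightarrow> real \<Rightarrow> (real ^ 'k::finite) set" where
  "param_cube \<alpha> \<beta> \<equiv> cbox (\<chi> i. \<alpha>) (\<chi> i. \<beta>)"

definition iid_vars :: "'w measure \<Rightarrow> 'b measure \<Rightarrow> ('i \<Rightarrow> 'w \<Rightarrow> 'b) \<Rightarrow> 'i set \<Rightarrow> bool" where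
  "iid_vars P N Z I \<longleftrightarrow>
     prob_space.indep_vars P (\<lambda>_. N) Z I \<and>
     (\<forall>i\<in>I. \<forall>j\<in>I. distr P N (Z i) = distr P N (Z j))"

text \<open>Powers with positive real exponent on \<open>[0,\<infinity>]\<close>, with \<open>\<infinity>\<close> raised to any such exponent
  being \<open>\<infinity>\<close>. They are needed for \<open>L\<^sup>p\<close>-norms of nonnegative functions that are not known
  in advance to be finite.\<close>
definition ennreal_powr :: "ennreal \<Rightarrow> real \<Rightarrow> ennreal" where
  "ennreal_powr x p = (if x = \<infinity> then \<infinity> else ennreal (enn2real x powr p))"

lemma ennreal_powr_ennreal: "x \<ge> 0 \<Longrightarrow> ennreal_powr (ennreal x) p = ennreal (x powr p)"
  by (simp add: ennreal_powr_def)

end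

theory Submission
  imports Defs
begin

text \<open>Fix \<open>C\<close> and \<open>\<epsilon>\<close>, and put \<open>q = max {1, p, k / \<epsilon>}\<close>, where \<open>k\<close> is the dimension of the parameter cube.
  For a single parameter, Hoeffding's lemma together with \<open>x powr q \<le> (q / (e s)) powr q * exp (s x)\<close>
  bounds the \<open>L\<^sup>q\<close>-norm of empirical minus true risk by \<open>b\<^sup>2 sqrt (q / M)\<close>. Cover the cube by at most
  \<open>max 1 ((\<beta> - \<alpha>) / r) ^ k\<close> balls of radius \<open>r = C b / (2 sqrt M L)\<close>. The maximum over the centres costs
  a factor \<open>max 1 ((\<beta> - \<alpha>) / r) powr (k / q)\<close> with \<open>k / q \<le> \<epsilon>\<close>, and since the deviation is
  \<open>4 b L\<close>-Lipschitz in the parameter, leaving the centres costs \<open>4 b L r = 2 C b\<^sup>2 / sqrt M\<close>.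
  With \<open>a = 2 sqrt M L (\<beta> - \<alpha>) / (C b)\<close>, the second inequality comes from \<open>\<epsilon> = 1 / ln (a\<^sup>2)\<close> if \<open>a > 1\<close>
  and from \<open>\<epsilon> = k\<close> otherwise.\<close>

section \<open>Exponential and polynomial moments of sums of bounded independent variables\<close>

text \<open>The exponential turns the sum into a product, independence lets the integral pass to the
  factors, and Hoeffding's lemma bounds each of them.\<close>

lemma (in indep_interval_bounded_random_variables) nn_integral_exp_centered_sum_le:
  assumes "l > 0"
  shows "(\<integral>\<^sup>+x. exp (l * (\<Sum>i\<in>I. X i x - expectation (X i))) \<partial>M)
           \<le> ennreal (exp (l\<^sup>2 * (\<Sum>i\<in>I. (b i - a i)\<^sup>2) / 8))"
proof -
  have "(\<integral>\<^sup>+x. exp (l * (\<Sum>i\<in>I. X i x - expectation (X i))) \<partial>M)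
      = (\<integral>\<^sup>+x. (\<Prod>i\<in>I. ennreal (exp (l * (X i x - expectation (X i))))) \<partial>M)"
    by (intro nn_integral_cong) (simp add: sum_distrib_left exp_sum fin prod_ennreal)
  also have "\<dots> = (\<Prod>i\<in>I. \<integral>\<^sup>+x. ennreal (exp (l * (X i x - expectation (X i)))) \<partial>M)"
    by (intro indep_vars_nn_integral fin indep_vars_compose2[OF indep]) auto
  also have "\<dots> \<le> (\<Prod>i\<in>I. ennreal (exp (l\<^sup>2 * (b i - a i)\<^sup>2 / 8)))"
  proof (intro prod_mono_ennreal)
    fix i assume "i \<in> I"
    then interpret interval_bounded_random_variable M "X i" "a i" "b i" ..
    show "(\<integral>\<^sup>+x. ennreal (exp (l * (X i x - expectation (X i)))) \<partial>M)
            \<le> ennreal (exp (l\<^sup>2 * (b i - a i)\<^sup>2 / 8))"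
      by (rule Hoeffdings_lemma_nn_integral) fact
  qed
  also have "\<dots> = ennreal (exp (l\<^sup>2 * (\<Sum>i\<in>I. (b i - a i)\<^sup>2) / 8))"
    by (simp add: prod_ennreal exp_sum[symmetric] fin sum_distrib_left sum_divide_distrib)
  finally show ?thesis .
qed

text \<open>This is \<open>ln y \<le> y - 1\<close> at \<open>y = s * x / q\<close>, multiplied by
  \<open>q\<close> and exponentiated. Equality holds at \<open>x = q / s\<close>. The free parameter
  \<open>s\<close> is optimised later.\<close>

lemma powr_le_exp:
  fixes x q s :: real
  assumes "0 \<le> x" "0 < q" "0 < s"
  shows "x powr q \<le> (q / s) powr q * exp (- q) * exp (s * x)"
proof (cases "x = 0")
  case False
  then have x: "x > 0" using assms by simp
  have "ln (s * x / q) \<le> s * x / q - 1"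
    using x assms by (intro ln_le_minus_one) auto
  then have "q * ln (s * x / q) \<le> q * (s * x / q - 1)"
    using assms by (intro mult_left_mono) auto
  then have "(s * x / q) powr q \<le> exp (s * x - q)"
    using x assms by (simp add: powr_def right_diff_distrib)
  then have "(q / s) powr q * (s * x / q) powr q \<le> (q / s) powr q * exp (s * x - q)"
    by (intro mult_left_mono) auto
  moreover have "(q / s) powr q * (s * x / q) powr q = x powr q"
    using x assms by (simp flip: powr_mult)
  ultimately show ?thesis
    by (simp add: exp_diff exp_minus field_simps)
qed simp

text \<open>The power of the absolute value is dominated by an exponential, and
  \<open>exp (s * \<bar>S x\<bar>)\<close> by the sum of the exponentials of \<open>s * S x\<close>
  and of its negative. Both have the same Hoeffding bound, so a factor 2 arises, which the remaining
  constants absorb.\<close>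

lemma (in indep_interval_bounded_random_variables) nn_integral_centered_sum_powr_le:
  assumes q: "1 \<le> q" and V: "V = (\<Sum>i\<in>I. (b i - a i)\<^sup>2)" "V > 0"
  shows "(\<integral>\<^sup>+x. ennreal (\<bar>\<Sum>i\<in>I. X i x - expectation (X i)\<bar> powr q) \<partial>M)
           \<le> ennreal (sqrt (q * V) powr q)"
proof -
  define S where "S x = (\<Sum>i\<in>I. X i x - expectation (X i))" for x
  \<comment> \<open>the minimiser of \<open>s powr (- q) * exp (s\<^sup>2 * V / 8)\<close>\<close>
  define s where "s = 2 * sqrt (q / V)"
  have s: "s > 0" using q V by (simp add: s_def)
  have [measurable]: "S \<in> borel_measurable M" unfolding S_def by measurable
  \<comment> \<open>Negation reflects the intervals and keeps their lengths, so the lower tail has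
    the same \<open>V\<close>.\<close>
  interpret neg: indep_interval_bounded_random_variables M I "\<lambda>i x. - X i x" "\<lambda>i. - b i" "\<lambda>i. - a i"
    using AE_in_interval by unfold_locales (auto intro!: fin indep_vars_compose2[OF indep])
  have sV: "s\<^sup>2 * V / 8 = q / 2"
    using q V(2) by (simp add: s_def power_mult_distrib)
  have pos: "(\<integral>\<^sup>+x. exp (s * S x) \<partial>M) \<le> ennreal (exp (q / 2))"
    using nn_integral_exp_centered_sum_le[OF s] by (simp add: S_def V(1)[symmetric] sV)
  have neg_S: "(\<Sum>i\<in>I. - X i x - expectation (\<lambda>x. - X i x)) = - S x" for x
    by (simp add: S_def sum_negf[symmetric])
  have neg: "(\<integral>\<^sup>+x. exp (s * - S x) \<partial>M) \<le> ennreal (exp (q / 2))"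
    using neg.nn_integral_exp_centered_sum_le[OF s, unfolded neg_S]
    by (simp add: V(1)[symmetric] sV)
  define K where "K = (q / s) powr q * exp (- q)"
  have K: "K \<ge> 0" by (simp add: K_def)
  have "(\<integral>\<^sup>+x. ennreal (\<bar>S x\<bar> powr q) \<partial>M)
      \<le> (\<integral>\<^sup>+x. ennreal K * (ennreal (exp (s * S x)) + ennreal (exp (s * - S x))) \<partial>M)"
  proof (intro nn_integral_mono)
    fix x
    have "\<bar>S x\<bar> powr q \<le> K * exp (s * \<bar>S x\<bar>)"
      unfolding K_def using q s by (intro powr_le_exp) auto
    also have "\<dots> \<le> K * (exp (s * S x) + exp (s * - S x))"
      using K by (intro mult_left_mono) (auto simp: abs_if)
    finally have "ennreal (\<bar>S x\<bar> powr q) \<le> ennreal (K * (exp (s * S x) + exp (s * - S x)))"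
      by (rule ennreal_leI)
    also have "\<dots> = ennreal K * (ennreal (exp (s * S x)) + ennreal (exp (s * - S x)))"
      using K by (simp add: ennreal_mult)
    finally show "ennreal (\<bar>S x\<bar> powr q) \<le> \<dots>" .
  qed
  also have "\<dots> = ennreal K * ((\<integral>\<^sup>+x. exp (s * S x) \<partial>M) + (\<integral>\<^sup>+x. exp (s * - S x) \<partial>M))"
    by (simp add: nn_integral_cmult nn_integral_add)
  also have "\<dots> \<le> ennreal K * (ennreal (exp (q / 2)) + ennreal (exp (q / 2)))"
    by (intro mult_left_mono add_mono pos neg) auto
  also have "\<dots> = ennreal (K * (2 * exp (q / 2)))"
    using K by (simp add: ennreal_mult flip: ennreal_plus)
  also have "K * (2 * exp (q / 2)) \<le> sqrt (q * V) powr q"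
  proof -
    have qs: "q / s = sqrt (q * V) / 2"
      using q V(2) by (simp add: s_def real_sqrt_divide real_sqrt_mult field_simps)
    have "K = sqrt (q * V) powr q / 2 powr q * exp (- q)"
      unfolding K_def qs using q V(2) by (simp add: powr_divide)
    moreover have "exp (- q) * exp (q / 2) = exp (q / 2 - q)"
      by (simp add: mult_exp_exp)
    ultimately have "K * (2 * exp (q / 2)) = (sqrt (q * V) powr q / 2 powr q) * (2 * exp (q / 2 - q))"
      by simp
    also have "\<dots> \<le> (sqrt (q * V) powr q / 2 powr q) * (2 powr q * 1)"
      using q V(2) powr_mono[of 1 q 2] by (intro mult_left_mono mult_mono) auto
    also have "\<dots> = sqrt (q * V) powr q" by simp
    finally show ?thesis .
  qed
  finally show ?thesis by (simp add: S_def ennreal_leI)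
qed

section \<open>Comparison of norms on a probability space\<close>

text \<open>Stands in for the inequalities of Jensen and Minkowski: both uses below reduce to a pointwise
  bound by a convex combination of a normalised \<open>q\<close>-th power and a constant.\<close>
lemma (in prob_space) nn_integral_affine_le:
  assumes h [measurable]: "h \<in> borel_measurable M" and "\<And>x. 0 \<le> h x"
    and h1: "(\<integral>\<^sup>+x. ennreal (h x) \<partial>M) \<le> 1" and t: "0 \<le> t" "t \<le> 1" and K: "0 \<le> K"
    and le: "\<And>x. x \<in> space M \<Longrightarrow> g x \<le> K * (t * h x + (1 - t))"
  shows "(\<integral>\<^sup>+x. ennreal (g x) \<partial>M) \<le> ennreal K"
proof -
  have "(\<integral>\<^sup>+x. ennreal (g x) \<partial>M) \<le> (\<integral>\<^sup>+x. ennreal (K * (t * h x + (1 - t))) \<partial>M)"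
    by (intro nn_integral_mono ennreal_leI le)
  also have "\<dots> = (\<integral>\<^sup>+x. ennreal K * (ennreal t * ennreal (h x) + ennreal (1 - t)) \<partial>M)"
    using assms by (intro nn_integral_cong) (simp add: ennreal_mult)
  also have "\<dots> = ennreal K * (ennreal t * (\<integral>\<^sup>+x. ennreal (h x) \<partial>M) + ennreal (1 - t))"
    by (simp add: nn_integral_cmult nn_integral_add emeasure_space_1)
  also have "\<dots> \<le> ennreal K * (ennreal t * 1 + ennreal (1 - t))"
    by (intro mult_left_mono add_mono h1) auto
  also have "\<dots> = ennreal K"
    using t by (simp flip: ennreal_plus)
  finally show ?thesis .
qed

text \<open>Young's inequality for \<open>(u / B) powr q\<close> and \<open>1\<close> with weights
  \<open>p / q\<close> and \<open>1 - p / q\<close>, scaled by \<open>B powr p\<close>. Equality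
  holds at \<open>u = B\<close>.\<close>

lemma powr_le_affine_powr:
  fixes u B p q :: real
  assumes "0 \<le> u" "0 < B" "0 < p" "p \<le> q"
  shows "u powr p \<le> B powr p * (p / q * (u powr q / B powr q) + (1 - p / q))"
proof (cases "u = 0")
  case False
  then have u: "u > 0" using assms by simp
  have "((u / B) powr q) powr (p / q) * 1 powr (1 - p / q)
      \<le> (p / q) * (u / B) powr q + (1 - p / q) * 1"
    using u assms by (intro Youngs_inequality_0) auto
  then have "(u / B) powr p \<le> (p / q) * (u / B) powr q + (1 - p / q)"
    using assms by (simp add: powr_powr)
  then have "B powr p * (u / B) powr p \<le> B powr p * ((p / q) * (u / B) powr q + (1 - p / q))"
    by (intro mult_left_mono) auto
  moreover have "B powr p * (u / B) powr p = u powr p"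
    using u assms by (simp add: powr_divide)
  ultimately show ?thesis
    using u assms by (simp add: powr_divide)
qed (use assms in auto)

text \<open>Convexity of the power function: with \<open>w = A / (A + c)\<close>, the point
  \<open>u + c\<close> is the mean of \<open>A + c\<close> and \<open>u / w\<close> with weights
  \<open>1 - w\<close> and \<open>w\<close>. This weight gives equality at \<open>u = A\<close>, so
  no constant is lost.\<close>

lemma add_powr_le_affine_powr:
  fixes u A c q :: real
  assumes "0 \<le> u" "0 < A" "0 < c" "1 \<le> q"
  shows "(u + c) powr q \<le>
    (A + c) powr q * (A / (A + c) * (u powr q / A powr q) + (1 - A / (A + c)))"
proof (cases "u = 0")
  case True
  \<comment> \<open>At \<open>u = 0\<close> the claim says that a ratio in the unit interval does
    not grow when raised to a power \<open>q \<ge> 1\<close>.\<close>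
  have "(c / (A + c)) powr q \<le> (c / (A + c)) powr 1"
    using assms by (intro powr_mono') auto
  then have "(A + c) powr q * (c / (A + c)) powr q \<le> (A + c) powr q * (c / (A + c))"
    using assms by (intro mult_left_mono) auto
  moreover have "(A + c) powr q * (c / (A + c)) powr q = c powr q"
    using assms by (simp add: powr_divide)
  moreover have "1 - A / (A + c) = c / (A + c)"
    using assms by (simp add: field_simps)
  ultimately show ?thesis using True assms by simp
next
  case False
  then have u: "u > 0" using assms by simp
  define w where "w = A / (A + c)"
  have w: "0 < w" "w < 1" "1 - w = c / (A + c)"
    using assms by (auto simp: w_def field_simps)
  have "((1 - w) *\<^sub>R (A + c) + w *\<^sub>R (u / w)) powr q
      \<le> (1 - w) * (A + c) powr q + w * (u / w) powr q"
    using w u assms by (intro convex_onD[OF powr_convex]) auto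
  also have "(1 - w) *\<^sub>R (A + c) + w *\<^sub>R (u / w) = u + c"
    using w assms by simp
  also have "(u / w) powr q = (A + c) powr q * (u powr q / A powr q)"
    using u assms by (simp add: w_def powr_divide powr_mult)
  finally show ?thesis by (simp add: w_def algebra_simps)
qed

text \<open>Monotonicity of norms in the exponent, by integrating the pointwise Young bound with
  \<open>h = u powr q / B powr q\<close>.\<close>

lemma (in prob_space) nn_integral_powr_mono_exponent:
  assumes [measurable]: "u \<in> borel_measurable M" and "\<And>x. 0 \<le> u x" "0 < B" "0 < p" "p \<le> q"
    and "(\<integral>\<^sup>+x. ennreal (u x powr q) \<partial>M) \<le> ennreal (B powr q)"
  shows "(\<integral>\<^sup>+x. ennreal (u x powr p) \<partial>M) \<le> ennreal (B powr p)"
proof (rule nn_integral_affine_le)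
  show "(\<integral>\<^sup>+x. ennreal (u x powr q / B powr q) \<partial>M) \<le> 1"
    using assms by (simp add: divide_ennreal[symmetric] nn_integral_divide divide_le_posI_ennreal)
  show "u x powr p \<le> B powr p * (p / q * (u x powr q / B powr q) + (1 - p / q))" for x
    using assms by (intro powr_le_affine_powr) auto
qed (use assms in auto)

text \<open>The triangle inequality for the \<open>q\<close>-norm when one summand is constant, by
  integrating the pointwise convexity bound.\<close>

lemma (in prob_space) nn_integral_add_const_powr_le:
  assumes [measurable]: "u \<in> borel_measurable M" and "\<And>x. 0 \<le> u x" "0 < A" "0 < c" "1 \<le> q"
    and "(\<integral>\<^sup>+x. ennreal (u x powr q) \<partial>M) \<le> ennreal (A powr q)"
  shows "(\<integral>\<^sup>+x. ennreal ((u x + c) powr q) \<partial>M) \<le> ennreal ((A + c) powr q)"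
proof (rule nn_integral_affine_le)
  show "(\<integral>\<^sup>+x. ennreal (u x powr q / A powr q) \<partial>M) \<le> 1"
    using assms by (simp add: divide_ennreal[symmetric] nn_integral_divide divide_le_posI_ennreal)
  show "(u x + c) powr q \<le>
    (A + c) powr q * (A / (A + c) * (u x powr q / A powr q) + (1 - A / (A + c)))" for x
    using assms by (intro add_powr_le_affine_powr) auto
qed (use assms in auto)

section \<open>From finitely many centres to the supremum over all parameters\<close>

text \<open>The maximum over \<open>T\<close> lies below the \<open>q\<close>-norm of the finite
  family, whose \<open>q\<close>-th moment is a sum of \<open>card T\<close> single moments. The
  supremum over \<open>S\<close> is only compared pointwise with this norm plus \<open>c\<close>, so
  \<open>S\<close> may be uncountable.\<close>

lemma (in prob_space) nn_integral_SUP_powr_le_net: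
  fixes \<Delta> :: "'i \<Rightarrow> 'a \<Rightarrow> real"
  assumes T: "finite T" and [measurable]: "\<And>t. t \<in> T \<Longrightarrow> \<Delta> t \<in> borel_measurable M"
    and moment: "\<And>t. t \<in> T \<Longrightarrow> (\<integral>\<^sup>+x. ennreal (\<bar>\<Delta> t x\<bar> powr q) \<partial>M) \<le> ennreal (B powr q)"
    and card: "real (card T) * B powr q \<le> A powr q"
    and A: "0 < A" and c: "0 < c" and p: "0 < p" "p \<le> q" and q: "1 \<le> q"
    and net: "\<And>\<theta> x. \<theta> \<in> S \<Longrightarrow> x \<in> space M \<Longrightarrow> \<exists>t\<in>T. \<bar>\<Delta> \<theta> x\<bar> \<le> \<bar>\<Delta> t x\<bar> + c"
  shows "(\<integral>\<^sup>+x. (SUP \<theta>\<in>S. ennreal (\<bar>\<Delta> \<theta> x\<bar> powr p)) \<partial>M) \<le> ennreal ((A + c) powr p)"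
proof -
  define g where "g x = (\<Sum>t\<in>T. \<bar>\<Delta> t x\<bar> powr q) powr (1 / q)" for x
  have [measurable]: "g \<in> borel_measurable M" unfolding g_def by measurable
  have g_powr: "g x powr q = (\<Sum>t\<in>T. \<bar>\<Delta> t x\<bar> powr q)" for x
    using q by (simp add: g_def powr_powr sum_nonneg)
  have le_g: "\<bar>\<Delta> t x\<bar> \<le> g x" if "t \<in> T" for t x
  proof -
    have "\<bar>\<Delta> t x\<bar> = (\<bar>\<Delta> t x\<bar> powr q) powr (1 / q)"
      using q by (simp add: powr_powr)
    also have "\<dots> \<le> g x"
      unfolding g_def using that T q by (intro powr_mono2 member_le_sum) auto
    finally show ?thesis .
  qed
  have "(\<integral>\<^sup>+x. ennreal (g x powr q) \<partial>M) = (\<Sum>t\<in>T. \<integral>\<^sup>+x. ennreal (\<bar>\<Delta> t x\<bar> powr q) \<partial>M)"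
    by (simp add: g_powr sum_ennreal[symmetric] nn_integral_sum del: sum_ennreal)
  also have "\<dots> \<le> (\<Sum>t\<in>T. ennreal (B powr q))"
    by (intro sum_mono moment)
  also have "\<dots> = ennreal (real (card T) * B powr q)"
    by (simp add: ennreal_mult ennreal_of_nat_eq_real_of_nat)
  also have "\<dots> \<le> ennreal (A powr q)"
    by (intro ennreal_leI card)
  \<comment> \<open>The constant is added at exponent \<open>q \<ge> 1\<close>, where convexity is
    available. Only afterwards is the exponent lowered to \<open>p\<close>, which may be less than
    1.\<close>
  finally have "(\<integral>\<^sup>+x. ennreal ((g x + c) powr q) \<partial>M) \<le> ennreal ((A + c) powr q)"
    using A c q by (intro nn_integral_add_const_powr_le) (auto simp: g_def)
  then have "(\<integral>\<^sup>+x. ennreal ((g x + c) powr p) \<partial>M) \<le> ennreal ((A + c) powr p)"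
    by (rule nn_integral_powr_mono_exponent[of "\<lambda>x. g x + c" "A + c" p q, rotated 5])
      (use A c p in \<open>auto simp: g_def\<close>)
  moreover have "(\<integral>\<^sup>+x. (SUP \<theta>\<in>S. ennreal (\<bar>\<Delta> \<theta> x\<bar> powr p)) \<partial>M)
      \<le> (\<integral>\<^sup>+x. ennreal ((g x + c) powr p) \<partial>M)"
  proof (intro nn_integral_mono SUP_least ennreal_leI powr_mono2)
    fix x \<theta> assume "x \<in> space M" "\<theta> \<in> S"
    from net[OF this(2,1)] obtain t where "t \<in> T" "\<bar>\<Delta> \<theta> x\<bar> \<le> \<bar>\<Delta> t x\<bar> + c" by blast
    with le_g[of t x] show "\<bar>\<Delta> \<theta> x\<bar> \<le> g x + c" by linarith
  qed (use p in auto)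
  ultimately show ?thesis by (rule order_trans[rotated])
qed

section \<open>Covering the parameter cube in the maximum norm\<close>

text \<open>Each edge is cut into \<open>n\<close> equal pieces of length at most
  \<open>2 * r\<close>, and the net consists of the midpoints of the resulting cells.\<close>

lemma param_cube_finite_net:
  fixes \<alpha> \<beta> r :: real
  assumes "\<alpha> < \<beta>" "0 < r"
  obtains T :: "(real ^ 'k::finite) set"
  where "finite T" "T \<subseteq> param_cube \<alpha> \<beta>" "real (card T) \<le> max 1 ((\<beta> - \<alpha>) / r) ^ CARD('k)"
    and "\<And>\<theta>. \<theta> \<in> param_cube \<alpha> \<beta> \<Longrightarrow> \<exists>t\<in>T. infnorm (\<theta> - t) \<le> r"
proof -
  define n where "n = nat \<lceil>(\<beta> - \<alpha>) / (2 * r)\<rceil>"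
  have n_ge: "(\<beta> - \<alpha>) / (2 * r) \<le> real n" unfolding n_def by linarith
  moreover have "0 < (\<beta> - \<alpha>) / (2 * r)" using assms by simp
  ultimately have n_pos: "0 < n" by linarith
  have n_le: "real n \<le> max 1 ((\<beta> - \<alpha>) / r)"
  proof (cases "(\<beta> - \<alpha>) / (2 * r) \<le> 1")
    case True
    then have "n \<le> 1" unfolding n_def by (simp add: ceiling_le_iff nat_le_iff)
    then show ?thesis by linarith
  next
    \<comment> \<open>Rounding up adds at most 1, hence at most doubles a quotient that exceeds 1.
      This turns the \<open>2 * r\<close> in the denominator into \<open>r\<close>.\<close>
    case False
    have "real n \<le> (\<beta> - \<alpha>) / (2 * r) + 1" using False unfolding n_def by linarith
    also have "\<dots> \<le> 2 * ((\<beta> - \<alpha>) / (2 * r))" using False by linarith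
    also have "\<dots> = (\<beta> - \<alpha>) / r" using assms by (simp add: field_simps)
    finally show ?thesis by simp
  qed
  \<comment> \<open>Half the edge of a cell, at most \<open>r\<close>, adjusted so that the
    \<open>n\<close> cells fill the edge exactly and all midpoints stay inside.\<close>
  define w where "w = (\<beta> - \<alpha>) / (2 * real n)"
  have w: "0 < w" "w \<le> r" "\<beta> = \<alpha> + 2 * real n * w"
    using assms n_pos n_ge by (auto simp: w_def field_simps)
  define c where "c i = \<alpha> + (2 * real i + 1) * w" for i :: nat
  have c_in: "c i \<in> {\<alpha>..\<beta>}" if "i < n" for i
  proof -
    have "2 * real i + 1 \<le> 2 * real n" using that by linarith
    then have "(2 * real i + 1) * w \<le> 2 * real n * w" using w by (intro mult_right_mono) auto
    then show ?thesis using w by (simp add: c_def)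
  qed
  have c_near: "\<exists>i<n. \<bar>x - c i\<bar> \<le> w" if x: "x \<in> {\<alpha>..\<beta>}" for x
  proof (cases "x = \<beta>")
    \<comment> \<open>The floor used below would give the index \<open>n\<close> at the right
      endpoint, one past the last cell, so this point is assigned to cell
      \<open>n - 1\<close>.\<close>
    case True
    have "\<bar>x - c (n - 1)\<bar> = w"
      using w n_pos True by (simp add: c_def of_nat_diff algebra_simps)
    then show ?thesis using n_pos by (intro exI[of _ "n - 1"]) auto
  next
    case False
    define i where "i = nat \<lfloor>(x - \<alpha>) / (2 * w)\<rfloor>"
    have "0 \<le> (x - \<alpha>) / (2 * w)" using x w by simp
    then have i: "real i \<le> (x - \<alpha>) / (2 * w)" "(x - \<alpha>) / (2 * w) < real i + 1"
      unfolding i_def by linarith+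
    have "(x - \<alpha>) / (2 * w) < real n" using x w False by (simp add: field_simps)
    with i have "i < n" by linarith
    moreover have "\<bar>x - c i\<bar> \<le> w"
      using i w by (simp add: c_def field_simps abs_le_iff)
    ultimately show ?thesis by blast
  qed
  define T :: "(real ^ 'k) set" where "T = (\<lambda>g. \<chi> i. c (g i)) ` (UNIV \<rightarrow>\<^sub>E {..<n})"
  have fin: "finite (UNIV \<rightarrow>\<^sub>E {..<n} :: ('k \<Rightarrow> nat) set)" by (intro finite_PiE) auto
  show thesis
  proof
    show "finite T" unfolding T_def using fin by (rule finite_imageI)
    have "card T \<le> n ^ CARD('k)"
      unfolding T_def using card_image_le[OF fin] by (simp add: card_funcsetE)
    then have "real (card T) \<le> real n ^ CARD('k)" by (metis of_nat_le_iff of_nat_power)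
    also have "\<dots> \<le> max 1 ((\<beta> - \<alpha>) / r) ^ CARD('k)" by (intro power_mono n_le) auto
    finally show "real (card T) \<le> max 1 ((\<beta> - \<alpha>) / r) ^ CARD('k)" .
    show "T \<subseteq> param_cube \<alpha> \<beta>"
      using c_in unfolding T_def by (fastforce simp: mem_box_cart PiE_iff)
    fix \<theta> :: "real ^ 'k" assume "\<theta> \<in> param_cube \<alpha> \<beta>"
    then have "\<forall>i. \<exists>j<n. \<bar>\<theta> $ i - c j\<bar> \<le> w"
      by (intro allI c_near) (simp add: mem_box_cart)
    then obtain g where g: "\<And>i. g i < n" "\<And>i. \<bar>\<theta> $ i - c (g i)\<bar> \<le> w" by metis
    have "(\<chi> i. c (g i)) \<in> T" using g by (auto simp: T_def)
    moreover have "infnorm (\<theta> - (\<chi> i. c (g i))) \<le> r"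
      unfolding infnorm_cart using g w(2) by (intro cSup_least) (auto intro: order_trans)
    ultimately show "\<exists>t\<in>T. infnorm (\<theta> - t) \<le> r" by blast
  qed
qed

section \<open>Measurability of an uncountable supremum\<close>

text \<open>The supremum may be restricted to a countable dense subset of the index set.\<close>
lemma borel_measurable_SUP_continuous:
  fixes F :: "'a::{metric_space, second_countable_topology} \<Rightarrow> 'w \<Rightarrow> real"
  assumes meas: "\<And>\<theta>. \<theta> \<in> S \<Longrightarrow> F \<theta> \<in> borel_measurable N"
    and cont: "\<And>\<omega>. \<omega> \<in> space N \<Longrightarrow> continuous_on S (\<lambda>\<theta>. F \<theta> \<omega>)"
  shows "(\<lambda>\<omega>. SUP \<theta>\<in>S. ennreal (F \<theta> \<omega>)) \<in> borel_measurable N"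
proof -
  obtain T where T: "countable T" "T \<subseteq> S" "S \<subseteq> closure T"
    using separable by blast
  have "(SUP \<theta>\<in>S. ennreal (F \<theta> \<omega>)) = (SUP \<theta>\<in>T. ennreal (F \<theta> \<omega>))" if \<omega>: "\<omega> \<in> space N" for \<omega>
  proof (intro antisym SUP_least)
    fix \<theta> assume \<theta>: "\<theta> \<in> S"
    with T(3) have "\<theta> \<in> closure T" by blast
    then obtain x where x: "\<And>n. x n \<in> T" "x \<longlonglongrightarrow> \<theta>"
      using closure_sequential[of \<theta> T] by auto
    have "(\<lambda>n. F (x n) \<omega>) \<longlonglongrightarrow> F \<theta> \<omega>"
      using cont[OF \<omega>] \<theta> x T(2) unfolding continuous_on_sequentially comp_def by blast
    then have "(\<lambda>n. ennreal (F (x n) \<omega>)) \<longlonglongrightarrow> ennreal (F \<theta> \<omega>)"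
      by (rule tendsto_ennrealI)
    then show "ennreal (F \<theta> \<omega>) \<le> (SUP \<theta>\<in>T. ennreal (F \<theta> \<omega>))"
      by (rule LIMSEQ_le_const2) (intro exI allI impI SUP_upper x(1))
  qed (use T(2) in \<open>auto intro: SUP_upper\<close>)
  moreover have "(\<lambda>\<omega>. SUP \<theta>\<in>T. ennreal (F \<theta> \<omega>)) \<in> borel_measurable N"
    using T meas by (intro borel_measurable_SUP) auto
  ultimately show ?thesis
    by (simp cong: measurable_cong)
qed

section \<open>Squared losses and the deviation of their empirical mean\<close>

lemma power2_diff_abs_le:
  fixes u v b :: real
  assumes "\<bar>u\<bar> \<le> b" "\<bar>v\<bar> \<le> b"
  shows "\<bar>u\<^sup>2 - v\<^sup>2\<bar> \<le> 2 * b * \<bar>u - v\<bar>"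
proof -
  have "\<bar>u\<^sup>2 - v\<^sup>2\<bar> = \<bar>u + v\<bar> * \<bar>u - v\<bar>"
    by (simp add: abs_mult[symmetric] power2_eq_square algebra_simps)
  also have "\<dots> \<le> 2 * b * \<bar>u - v\<bar>"
    using assms by (intro mult_right_mono) auto
  finally show ?thesis .
qed

text \<open>All \<open>n\<close> intervals have length \<open>B\<close>, so the moment bound applies
  with \<open>V = n * B\<^sup>2\<close>. Dividing by \<open>n\<close> leaves the rate
  \<open>B * sqrt (q / n)\<close>.\<close>

lemma (in prob_space) nn_integral_mean_deviation_powr_le:
  fixes Z :: "nat \<Rightarrow> 'a \<Rightarrow> real"
  assumes indep: "indep_vars (\<lambda>_. borel) Z {1..n}" and n: "1 \<le> n"
    and bnd: "\<And>j x. j \<in> {1..n} \<Longrightarrow> x \<in> space M \<Longrightarrow> Z j x \<in> {0..B}"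
    and mean: "\<And>j. j \<in> {1..n} \<Longrightarrow> expectation (Z j) = m"
    and B: "0 < B" and q: "1 \<le> q"
  shows "(\<integral>\<^sup>+x. ennreal (\<bar>1 / real n * (\<Sum>j=1..n. Z j x) - m\<bar> powr q) \<partial>M)
           \<le> ennreal ((B * sqrt q / sqrt (real n)) powr q)"
proof -
  interpret indep_interval_bounded_random_variables M "{1..n}" Z "\<lambda>_. 0" "\<lambda>_. B"
  proof unfold_locales
    show "indep_vars (\<lambda>_. borel) Z {1..n}" by (rule indep)
    show "AE x in M. Z j x \<in> {0..B}" if "j \<in> {1..n}" for j
      using bnd[OF that] by (intro AE_I2) simp
  qed simp
  define S where "S x = (\<Sum>j=1..n. Z j x - expectation (Z j))" for x
  have [measurable]: "S \<in> borel_measurable M" unfolding S_def by measurable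
  have S: "1 / real n * (\<Sum>j=1..n. Z j x) - m = S x / real n" for x
    using n mean by (simp add: S_def sum_subtractf field_simps)
  have "(\<integral>\<^sup>+x. ennreal (\<bar>1 / real n * (\<Sum>j=1..n. Z j x) - m\<bar> powr q) \<partial>M)
      = (\<integral>\<^sup>+x. ennreal (\<bar>S x\<bar> powr q) * ennreal (1 / real n powr q) \<partial>M)"
    unfolding S by (intro nn_integral_cong) (simp add: powr_divide flip: ennreal_mult)
  also have "\<dots> = (\<integral>\<^sup>+x. ennreal (\<bar>S x\<bar> powr q) \<partial>M) * ennreal (1 / real n powr q)"
    by (intro nn_integral_multc) measurable
  also have "\<dots> \<le> ennreal (sqrt (q * (real n * B\<^sup>2)) powr q) * ennreal (1 / real n powr q)"
    using n B q nn_integral_centered_sum_powr_le[of q "real n * B\<^sup>2"]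
    by (intro mult_right_mono) (auto simp: S_def)
  also have "\<dots> = ennreal ((sqrt (q * (real n * B\<^sup>2)) / real n) powr q)"
    using q by (simp add: powr_divide flip: ennreal_mult)
  also have "sqrt (q * (real n * B\<^sup>2)) / real n = B * sqrt q / sqrt (real n)"
    using n B by (simp add: real_sqrt_mult field_simps)
  finally show ?thesis .
qed

section \<open>Choice of the exponent for the second inequality\<close>

lemma ex_exponent_le:
  fixes a p n :: real
  assumes "0 < a" "0 < n"
  shows "\<exists>\<epsilon>>0. max 1 (a powr \<epsilon>) * sqrt (Max {1, p, n / \<epsilon>}) \<le> sqrt (exp 1 * Max {1, p, n * ln (a\<^sup>2)})"
proof (cases "a \<le> 1")
  case True
  have "max 1 (a powr n) * sqrt (Max {1, p, n / n}) = sqrt (Max {1, p})"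
    using True assms powr_le1[of n a] by (simp add: max_def)
  also have "\<dots> \<le> sqrt (exp 1 * Max {1, p, n * ln (a\<^sup>2)})"
  proof (intro real_sqrt_le_mono)
    have "Max {1, p} \<le> 1 * Max {1, p, n * ln (a\<^sup>2)}" by (simp add: max_def)
    also have "\<dots> \<le> exp 1 * Max {1, p, n * ln (a\<^sup>2)}"
      by (intro mult_right_mono) (auto simp: le_max_iff_disj)
    finally show "Max {1, p} \<le> exp 1 * Max {1, p, n * ln (a\<^sup>2)}" .
  qed
  finally show ?thesis using assms by blast
next
  case False
  \<comment> \<open>This makes \<open>a powr \<epsilon>\<close> equal to \<open>exp (1 / 2)\<close>
    whatever \<open>a\<close> is, which is the source of the factor \<open>exp 1\<close> under the
    root, while \<open>n / \<epsilon>\<close> becomes the logarithmic term.\<close>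
  define \<epsilon> where "\<epsilon> = 1 / ln (a\<^sup>2)"
  have ln_pos: "0 < ln (a\<^sup>2)" using False by (simp add: ln_realpow)
  have "a powr \<epsilon> = exp (1 / 2)"
    using False assms ln_pos by (simp add: powr_def \<epsilon>_def ln_realpow)
  moreover have "sqrt (exp 1) = exp (1 / 2 :: real)"
    by (rule real_sqrt_unique) (simp_all add: power2_eq_square mult_exp_exp)
  ultimately have "max 1 (a powr \<epsilon>) = sqrt (exp 1)"
    by (simp add: max_def)
  then have "max 1 (a powr \<epsilon>) * sqrt (Max {1, p, n / \<epsilon>}) = sqrt (exp 1 * Max {1, p, n * ln (a\<^sup>2)})"
    by (simp add: real_sqrt_mult \<epsilon>_def)
  moreover have "\<epsilon> > 0" using ln_pos by (simp add: \<epsilon>_def)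
  ultimately show ?thesis by force
qed

theorem proposition4p14:
  fixes M :: nat
    and L b \<alpha> \<beta> :: real
    and D :: "(real ^ 'd::finite) set"
    and P :: "'w measure"
    and X :: "nat \<Rightarrow> 'w \<Rightarrow> real ^ 'd"
    and Y :: "nat \<Rightarrow> 'w \<Rightarrow> real"
    and f :: "real ^ 'k::finite \<Rightarrow> real ^ 'd \<Rightarrow> real"
    and risk :: "real ^ 'k \<Rightarrow> real"
    and emp_risk :: "real ^ 'k \<Rightarrow> 'w \<Rightarrow> real"
  assumes "M \<ge> 1" and "L > 0" and "b > 0" and "\<alpha> < \<beta>"
    and "prob_space P"
    and "\<And>j. j \<in> {1..M} \<Longrightarrow> X j \<in> space P \<rightarrow> D"
    and "iid_vars P (restrict_space borel D \<Otimes>\<^sub>M borel) (\<lambda>j \<omega>. (X j \<omega>, Y j \<omega>)) {1..M}"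
    and "\<And>\<theta>. \<theta> \<in> param_cube \<alpha> \<beta> \<Longrightarrow> continuous_on D (f \<theta>)"
    and "\<And>\<theta> j \<omega>. \<lbrakk>\<theta> \<in> param_cube \<alpha> \<beta>; j \<in> {1..M}; \<omega> \<in> space P\<rbrakk>
           \<Longrightarrow> \<bar>f \<theta> (X j \<omega>) - Y j \<omega>\<bar> \<le> b"
    and "\<And>\<theta> \<theta>' x. \<lbrakk>\<theta> \<in> param_cube \<alpha> \<beta>; \<theta>' \<in> param_cube \<alpha> \<beta>; x \<in> D\<rbrakk>
           \<Longrightarrow> \<bar>f \<theta> x - f \<theta>' x\<bar> \<le> L * infnorm (\<theta> - \<theta>')"
    and "\<And>\<theta>. \<theta> \<in> param_cube \<alpha> \<beta> \<Longrightarrow> 0 \<le> risk \<theta>"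
    and "\<And>\<theta>. \<theta> \<in> param_cube \<alpha> \<beta> \<Longrightarrow>
           risk \<theta> = prob_space.expectation P (\<lambda>\<omega>. \<bar>f \<theta> (X 1 \<omega>) - Y 1 \<omega>\<bar>\<^sup>2)"
    and "\<And>\<theta> \<omega>. \<lbrakk>\<theta> \<in> param_cube \<alpha> \<beta>; \<omega> \<in> space P\<rbrakk> \<Longrightarrow> 0 \<le> emp_risk \<theta> \<omega>"
    and "\<And>\<theta> \<omega>. \<lbrakk>\<theta> \<in> param_cube \<alpha> \<beta>; \<omega> \<in> space P\<rbrakk> \<Longrightarrow>
           emp_risk \<theta> \<omega> = 1 / real M * (\<Sum>j=1..M. \<bar>f \<theta> (X j \<omega>) - Y j \<omega>\<bar>\<^sup>2)"
  shows "(\<lambda>\<omega>. SUP \<theta>\<in>param_cube \<alpha> \<beta>. ennreal \<bar>emp_risk \<theta> \<omega> - risk \<theta>\<bar>) \<in> borel_measurable P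
    \<and> (\<forall>p>0.
         ennreal_powr
           (\<integral>\<^sup>+\<omega>. (SUP \<theta>\<in>param_cube \<alpha> \<beta>. ennreal (\<bar>emp_risk \<theta> \<omega> - risk \<theta>\<bar> powr p)) \<partial>P)
           (1 / p)
         \<le> ennreal (INF (C, \<epsilon>)\<in>{0<..} \<times> {0<..}.
             2 * (C + 1) * b\<^sup>2
             * max 1 ((2 * sqrt (real M) * L * (\<beta> - \<alpha>) * inverse (C * b)) powr \<epsilon>)
             * sqrt (Max {1, p, real CARD('k) / \<epsilon>})
             / sqrt (real M))
       \<and> (INF (C, \<epsilon>)\<in>{0<..} \<times> {0<..}.
             2 * (C + 1) * b\<^sup>2
             * max 1 ((2 * sqrt (real M) * L * (\<beta> - \<alpha>) * inverse (C * b)) powr \<epsilon>)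
             * sqrt (Max {1, p, real CARD('k) / \<epsilon>})
             / sqrt (real M))
         \<le> (INF C\<in>{0<..}.
             2 * (C + 1) * b\<^sup>2
             * sqrt (exp 1 * Max {1, p, real CARD('k)
                 * ln (4 * real M * L\<^sup>2 * (\<beta> - \<alpha>)\<^sup>2 * (inverse (C * b))\<^sup>2)})
             / sqrt (real M)))"
proof -

  \<comment> \<open>The squared losses as bounded i.i.d. variables\<close>
  interpret prob_space P by fact
  note X_in = \<open>\<And>j. j \<in> {1..M} \<Longrightarrow> X j \<in> space P \<rightarrow> D\<close>
  note bounded = \<open>\<And>\<theta> j \<omega>. \<lbrakk>\<theta> \<in> param_cube \<alpha> \<beta>; j \<in> {1..M}; \<omega> \<in> space P\<rbrakk>
           \<Longrightarrow> \<bar>f \<theta> (X j \<omega>) - Y j \<omega>\<bar> \<le> b\<close>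
  note M = \<open>M \<ge> 1\<close> and L = \<open>L > 0\<close> and b = \<open>b > 0\<close> and \<alpha>\<beta> = \<open>\<alpha> < \<beta>\<close>
  define Z where "Z \<theta> j \<omega> = (f \<theta> (X j \<omega>) - Y j \<omega>)\<^sup>2" for \<theta> j \<omega>
  define \<Delta> where "\<Delta> \<theta> \<omega> = emp_risk \<theta> \<omega> - risk \<theta>" for \<theta> \<omega>
  let ?N = "restrict_space borel D \<Otimes>\<^sub>M (borel :: real measure)"
  let ?V = "\<lambda>j \<omega>. (X j \<omega>, Y j \<omega>)"
  have indep_V: "indep_vars (\<lambda>_. ?N) ?V {1..M}"
    and distr_V: "\<And>i j. i \<in> {1..M} \<Longrightarrow> j \<in> {1..M} \<Longrightarrow> distr P ?N (?V i) = distr P ?N (?V j)"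
    using assms(7) unfolding iid_vars_def by blast+
  have V: "?V j \<in> measurable P ?N" if "j \<in> {1..M}" for j
    using indep_V that unfolding indep_vars_def by blast
  \<comment> \<open>\<open>D\<close> is an arbitrary set and \<open>f \<theta>\<close> is continuous
    only on it, so measurability is taken relative to the Borel sets restricted to
    \<open>D\<close>.\<close>
  have loss: "(\<lambda>z. (f \<theta> (fst z) - snd z)\<^sup>2) \<in> borel_measurable ?N" if "\<theta> \<in> param_cube \<alpha> \<beta>" for \<theta>
  proof -
    have [measurable]: "f \<theta> \<in> borel_measurable (restrict_space borel D)"
      using that by (intro borel_measurable_continuous_on_restrict assms(8))
    show ?thesis by measurable
  qed
  have Z_meas: "Z \<theta> j \<in> borel_measurable P" if "\<theta> \<in> param_cube \<alpha> \<beta>" "j \<in> {1..M}" for \<theta> j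
    using measurable_compose[OF V[OF that(2)] loss[OF that(1)]] by (simp add: Z_def[abs_def])
  have Z_indep: "indep_vars (\<lambda>_. borel) (Z \<theta>) {1..M}" if "\<theta> \<in> param_cube \<alpha> \<beta>" for \<theta>
    using indep_vars_compose2[OF indep_V, of "\<lambda>_ z. (f \<theta> (fst z) - snd z)\<^sup>2" "\<lambda>_. borel"] loss[OF that]
    by (simp add: Z_def[abs_def])
  have Z_bnd: "Z \<theta> j \<omega> \<in> {0..b\<^sup>2}"
    if "\<theta> \<in> param_cube \<alpha> \<beta>" "j \<in> {1..M}" "\<omega> \<in> space P" for \<theta> j \<omega>
    using bounded[OF that] b by (simp add: Z_def abs_le_square_iff[symmetric])
  have Z_int: "integrable P (Z \<theta> j)" if "\<theta> \<in> param_cube \<alpha> \<beta>" "j \<in> {1..M}" for \<theta> j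
    using Z_bnd[OF that] Z_meas[OF that] by (intro integrable_const_bound[where B = "b\<^sup>2"] AE_I2) auto
  have risk: "risk \<theta> = expectation (Z \<theta> 1)" if "\<theta> \<in> param_cube \<alpha> \<beta>" for \<theta>
    using assms(12)[OF that] by (simp add: Z_def[abs_def])
  have Z_mean: "expectation (Z \<theta> j) = risk \<theta>" if \<theta>: "\<theta> \<in> param_cube \<alpha> \<beta>" and j: "j \<in> {1..M}" for \<theta> j
  proof -
    \<comment> \<open>The expectation depends only on the law of the pair, which is the same for all
      indices.\<close>
    have *: "expectation (Z \<theta> i) = (\<integral>z. (f \<theta> (fst z) - snd z)\<^sup>2 \<partial>distr P ?N (?V i))"
      if "i \<in> {1..M}" for i
      using integral_distr[OF V[OF that] loss[OF \<theta>]] by (simp add: Z_def[abs_def])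
    have "1 \<in> {1..M}" using M by simp
    then show ?thesis
      unfolding risk[OF \<theta>] using *[OF j] *[of 1] distr_V[OF j, of 1] by simp
  qed
  have emp: "emp_risk \<theta> \<omega> = 1 / real M * (\<Sum>j=1..M. Z \<theta> j \<omega>)"
    if "\<theta> \<in> param_cube \<alpha> \<beta>" "\<omega> \<in> space P" for \<theta> \<omega>
    using assms(14)[OF that] by (simp add: Z_def)
  have \<Delta>: "\<Delta> \<theta> \<omega> = 1 / real M * (\<Sum>j=1..M. Z \<theta> j \<omega>) - risk \<theta>"
    if "\<theta> \<in> param_cube \<alpha> \<beta>" "\<omega> \<in> space P" for \<theta> \<omega>
    using emp[OF that] by (simp add: \<Delta>_def)
  have \<Delta>_meas: "\<Delta> \<theta> \<in> borel_measurable P" if "\<theta> \<in> param_cube \<alpha> \<beta>" for \<theta>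
  proof -
    have "(\<lambda>\<omega>. 1 / real M * (\<Sum>j=1..M. Z \<theta> j \<omega>) - risk \<theta>) \<in> borel_measurable P"
      using Z_meas[OF that] by (intro borel_measurable_diff borel_measurable_times
        borel_measurable_sum borel_measurable_const) auto
    then show ?thesis using \<Delta>[OF that] by (simp cong: measurable_cong)
  qed
  have moment: "(\<integral>\<^sup>+\<omega>. ennreal (\<bar>\<Delta> \<theta> \<omega>\<bar> powr q) \<partial>P) \<le> ennreal ((b\<^sup>2 * sqrt q / sqrt (real M)) powr q)"
    if \<theta>: "\<theta> \<in> param_cube \<alpha> \<beta>" and q: "1 \<le> q" for \<theta> q
  proof -
    have "(\<integral>\<^sup>+\<omega>. ennreal (\<bar>\<Delta> \<theta> \<omega>\<bar> powr q) \<partial>P)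
        = (\<integral>\<^sup>+\<omega>. ennreal (\<bar>1 / real M * (\<Sum>j=1..M. Z \<theta> j \<omega>) - risk \<theta>\<bar> powr q) \<partial>P)"
      by (intro nn_integral_cong) (simp add: \<Delta>[OF \<theta>])
    also have "\<dots> \<le> ennreal ((b\<^sup>2 * sqrt q / sqrt (real M)) powr q)"
      using M b q Z_bnd[OF \<theta>] Z_mean[OF \<theta>] by (intro nn_integral_mean_deviation_powr_le Z_indep[OF \<theta>]) auto
    finally show ?thesis .
  qed

  \<comment> \<open>Lipschitz dependence of the deviation on the parameter\<close>
  have Z_lip: "\<bar>Z \<theta> j \<omega> - Z \<theta>' j \<omega>\<bar> \<le> 2 * b * L * infnorm (\<theta> - \<theta>')"
    if \<theta>: "\<theta> \<in> param_cube \<alpha> \<beta>" "\<theta>' \<in> param_cube \<alpha> \<beta>" and j: "j \<in> {1..M}" "\<omega> \<in> space P" for \<theta> \<theta>' j \<omega>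
  proof -
    have "\<bar>Z \<theta> j \<omega> - Z \<theta>' j \<omega>\<bar> \<le> 2 * b * \<bar>f \<theta> (X j \<omega>) - f \<theta>' (X j \<omega>)\<bar>"
      unfolding Z_def using power2_diff_abs_le[OF bounded[OF \<theta>(1) j] bounded[OF \<theta>(2) j]] by simp
    also have "\<dots> \<le> 2 * b * (L * infnorm (\<theta> - \<theta>'))"
      using b X_in[OF j(1)] j(2) by (intro mult_left_mono assms(10) \<theta>) auto
    finally show ?thesis by (simp add: mult_ac)
  qed
  \<comment> \<open>The constant 4 is twice the constant 2 of \<open>Z_lip\<close>, once for the
    empirical risk and once for the true risk.\<close>
  have \<Delta>_lip: "\<bar>\<Delta> \<theta> \<omega> - \<Delta> \<theta>' \<omega>\<bar> \<le> 4 * b * L * infnorm (\<theta> - \<theta>')"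
    if \<theta>: "\<theta> \<in> param_cube \<alpha> \<beta>" "\<theta>' \<in> param_cube \<alpha> \<beta>" and \<omega>: "\<omega> \<in> space P" for \<theta> \<theta>' \<omega>
  proof -
    let ?l = "2 * b * L * infnorm (\<theta> - \<theta>')"
    have 1: "1 \<in> {1..M}" using M by simp
    have "\<bar>\<Sum>j=1..M. Z \<theta> j \<omega> - Z \<theta>' j \<omega>\<bar> \<le> (\<Sum>j=1..M. ?l)"
      by (intro order_trans[OF sum_abs] sum_mono Z_lip \<theta> \<omega>)
    then have "\<bar>1 / real M * (\<Sum>j=1..M. Z \<theta> j \<omega> - Z \<theta>' j \<omega>)\<bar> \<le> ?l"
      using M by (simp add: abs_mult field_simps)
    then have emp_lip: "\<bar>emp_risk \<theta> \<omega> - emp_risk \<theta>' \<omega>\<bar> \<le> ?l"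
      by (simp add: emp \<theta> \<omega> sum_subtractf right_diff_distrib)
    have "\<bar>risk \<theta> - risk \<theta>'\<bar> = \<bar>expectation (\<lambda>\<omega>. Z \<theta> 1 \<omega> - Z \<theta>' 1 \<omega>)\<bar>"
      using Bochner_Integration.integral_diff[OF Z_int[OF \<theta>(1) 1] Z_int[OF \<theta>(2) 1]]
      by (simp add: risk \<theta>)
    also have "\<dots> \<le> expectation (\<lambda>\<omega>. \<bar>Z \<theta> 1 \<omega> - Z \<theta>' 1 \<omega>\<bar>)"
      by (rule integral_abs_bound)
    also have "\<dots> \<le> ?l"
      using Z_lip[OF \<theta> 1] Z_int[OF \<theta>(1) 1] Z_int[OF \<theta>(2) 1] by (intro integral_le_const AE_I2) auto
    finally show ?thesis
      using emp_lip unfolding \<Delta>_def by linarith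
  qed

  \<comment> \<open>Measurability of the maximal deviation\<close>
  have measurable_SUP: "(\<lambda>\<omega>. SUP \<theta>\<in>param_cube \<alpha> \<beta>. ennreal \<bar>\<Delta> \<theta> \<omega>\<bar>) \<in> borel_measurable P"
  proof (rule borel_measurable_SUP_continuous)
    show "(\<lambda>\<omega>. \<bar>\<Delta> \<theta> \<omega>\<bar>) \<in> borel_measurable P" if "\<theta> \<in> param_cube \<alpha> \<beta>" for \<theta>
      using \<Delta>_meas[OF that] by measurable
    fix \<omega> assume \<omega>: "\<omega> \<in> space P"
    have "(4 * b * L)-lipschitz_on (param_cube \<alpha> \<beta>) (\<lambda>\<theta>. \<Delta> \<theta> \<omega>)"
    proof (rule lipschitz_onI)
      fix \<theta> \<theta>' :: "real ^ 'k" assume \<theta>: "\<theta> \<in> param_cube \<alpha> \<beta>" "\<theta>' \<in> param_cube \<alpha> \<beta>"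
      have "\<bar>\<Delta> \<theta> \<omega> - \<Delta> \<theta>' \<omega>\<bar> \<le> 4 * b * L * infnorm (\<theta> - \<theta>')"
        by (rule \<Delta>_lip[OF \<theta> \<omega>])
      also have "\<dots> \<le> 4 * b * L * norm (\<theta> - \<theta>')"
        using b L by (intro mult_left_mono infnorm_le_norm) auto
      finally show "dist (\<Delta> \<theta> \<omega>) (\<Delta> \<theta>' \<omega>) \<le> 4 * b * L * dist \<theta> \<theta>'"
        by (simp add: dist_norm)
    qed (use b L in simp)
    then show "continuous_on (param_cube \<alpha> \<beta>) (\<lambda>\<theta>. \<bar>\<Delta> \<theta> \<omega>\<bar>)"
      by (intro continuous_on_rabs lipschitz_on_continuous_on)
  qed

  \<comment> \<open>Moment bound for fixed constants\<close>
  define G where "G p C \<epsilon> = 2 * (C + 1) * b\<^sup>2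
      * max 1 ((2 * sqrt (real M) * L * (\<beta> - \<alpha>) * inverse (C * b)) powr \<epsilon>)
      * sqrt (Max {1, p, real CARD('k) / \<epsilon>}) / sqrt (real M)" for p C \<epsilon>
  define H where "H p C = 2 * (C + 1) * b\<^sup>2
      * sqrt (exp 1 * Max {1, p, real CARD('k)
          * ln (4 * real M * L\<^sup>2 * (\<beta> - \<alpha>)\<^sup>2 * (inverse (C * b))\<^sup>2)}) / sqrt (real M)" for p C
  define I where "I p = (\<integral>\<^sup>+\<omega>. (SUP \<theta>\<in>param_cube \<alpha> \<beta>. ennreal (\<bar>\<Delta> \<theta> \<omega>\<bar> powr p)) \<partial>P)" for p
  have G_nonneg: "0 \<le> G p C \<epsilon>" if "0 < C" for p C \<epsilon>
    using that b by (simp add: G_def)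

  have I_le: "I p \<le> ennreal (G p C \<epsilon> powr p)" if p: "0 < p" and C: "0 < C" and \<epsilon>: "0 < \<epsilon>" for p C \<epsilon>
  proof -
    define q where "q = Max {1, p, real CARD('k) / \<epsilon>}"
    have q: "1 \<le> q" "p \<le> q" "real CARD('k) / \<epsilon> \<le> q" by (auto simp: q_def)
    define r where "r = C * b / (2 * sqrt (real M) * L)"
    have r: "0 < r" using C b M L by (simp add: r_def)
    define a where "a = 2 * sqrt (real M) * L * (\<beta> - \<alpha>) * inverse (C * b)"
    have a: "0 < a" using C b M L \<alpha>\<beta> by (simp add: a_def)
    have ar: "(\<beta> - \<alpha>) / r = a" by (simp add: a_def r_def field_simps)
    define B where "B = b\<^sup>2 * sqrt q / sqrt (real M)"
    have B: "0 < B" using b q M by (simp add: B_def)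
    define A where "A = max 1 (a powr \<epsilon>) * B"
    have A: "0 < A" using B by (simp add: A_def)
    define c where "c = 4 * b * L * r"
    have c: "0 < c" using b L r by (simp add: c_def)
    obtain T :: "(real ^ 'k) set" where T: "finite T" "T \<subseteq> param_cube \<alpha> \<beta>"
        "real (card T) \<le> max 1 a ^ CARD('k)"
        "\<And>\<theta>. \<theta> \<in> param_cube \<alpha> \<beta> \<Longrightarrow> \<exists>t\<in>T. infnorm (\<theta> - t) \<le> r"
      using param_cube_finite_net[OF \<alpha>\<beta> r] unfolding ar by metis
    \<comment> \<open>By the choice of \<open>q\<close> the dimension is at most
      \<open>\<epsilon> * q\<close>, so the size of the net is at most the \<open>q\<close>-th power
      of \<open>max 1 (a powr \<epsilon>)\<close>. Its \<open>q\<close>-th root is the factor in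
      \<open>A\<close>.\<close>
    have "max 1 a ^ CARD('k) = max 1 a powr real CARD('k)"
      by (simp add: powr_realpow)
    also have "\<dots> \<le> max 1 a powr (\<epsilon> * q)"
      using q(3) \<epsilon> by (intro powr_mono) (auto simp: field_simps)
    also have "\<dots> = (max 1 a powr \<epsilon>) powr q"
      by (simp add: powr_powr)
    also have "max 1 a powr \<epsilon> = max 1 (a powr \<epsilon>)"
      using a \<epsilon> powr_le1[of \<epsilon> a] ge_one_powr_ge_zero[of a \<epsilon>] by (auto simp: max_def)
    finally have "real (card T) \<le> max 1 (a powr \<epsilon>) powr q" using T(3) by linarith
    then have card: "real (card T) * B powr q \<le> A powr q"
      using B by (simp add: A_def powr_mult mult_right_mono)
    have "I p \<le> ennreal ((A + c) powr p)"
      unfolding I_def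
    proof (rule nn_integral_SUP_powr_le_net[OF T(1) _ _ card A c p q(2,1)])
      show "\<Delta> t \<in> borel_measurable P" if "t \<in> T" for t
        using \<Delta>_meas T(2) that by blast
      show "(\<integral>\<^sup>+\<omega>. ennreal (\<bar>\<Delta> t \<omega>\<bar> powr q) \<partial>P) \<le> ennreal (B powr q)" if "t \<in> T" for t
        unfolding B_def using moment T(2) that q(1) by blast
      fix \<theta> :: "real ^ 'k" and \<omega> assume \<theta>: "\<theta> \<in> param_cube \<alpha> \<beta>" and \<omega>: "\<omega> \<in> space P"
      obtain t where t: "t \<in> T" "infnorm (\<theta> - t) \<le> r" using T(4)[OF \<theta>] by blast
      have "\<bar>\<Delta> \<theta> \<omega> - \<Delta> t \<omega>\<bar> \<le> 4 * b * L * infnorm (\<theta> - t)"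
        using \<Delta>_lip[OF \<theta> _ \<omega>] t(1) T(2) by blast
      also have "\<dots> \<le> c"
        unfolding c_def using b L t(2) by (intro mult_left_mono) auto
      finally show "\<exists>t\<in>T. \<bar>\<Delta> \<theta> \<omega>\<bar> \<le> \<bar>\<Delta> t \<omega>\<bar> + c"
        using t(1) by (intro bexI[of _ t]) linarith+
    qed
    also have "(A + c) powr p \<le> G p C \<epsilon> powr p"
    proof (intro powr_mono2)
      \<comment> \<open>Both \<open>max 1 (a powr \<epsilon>)\<close> and \<open>sqrt q\<close> are
        at least 1, so \<open>c\<close> is at most \<open>2 * C * A\<close>. Then
        \<open>A + c\<close> is at most \<open>(2 * C + 1) * A\<close>, which is rounded up to
        \<open>2 * (C + 1) * A\<close>.\<close>
      have "c = 2 * C * b\<^sup>2 / sqrt (real M)"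
        using L M by (simp add: c_def r_def power2_eq_square)
      also have "\<dots> = 2 * C * b\<^sup>2 * (1 * 1) / sqrt (real M)" by simp
      also have "\<dots> \<le> 2 * C * b\<^sup>2 * (max 1 (a powr \<epsilon>) * sqrt q) / sqrt (real M)"
        using C q by (intro divide_right_mono mult_left_mono mult_mono) auto
      also have "\<dots> = 2 * C * A" by (simp add: A_def B_def)
      finally have "A + c \<le> 2 * (C + 1) * A" using A by (simp add: algebra_simps)
      also have "\<dots> = G p C \<epsilon>"
        by (simp add: G_def A_def B_def a_def q_def)
      finally show "A + c \<le> G p C \<epsilon>" .
    qed (use A c p in auto)
    finally show ?thesis by (simp add: ennreal_leI)
  qed

  \<comment> \<open>Passage to the infima\<close>
  have bound1: "ennreal_powr (I p) (1 / p) \<le> ennreal (INF (C, \<epsilon>)\<in>{0<..} \<times> {0<..}. G p C \<epsilon>)"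
    if p: "0 < p" for p
  proof -
    \<comment> \<open>Finiteness comes first, from one arbitrary pair of constants, because
      \<open>enn2real\<close> would send an infinite integral to 0.\<close>
    have "I p < \<infinity>"
      using I_le[OF p, of 1 1] by (simp add: le_less_trans)
    then have fin: "I p = ennreal (enn2real (I p))" "I p \<noteq> \<infinity>" by auto
    have "enn2real (I p) powr (1 / p) \<le> (INF (C, \<epsilon>)\<in>{0<..} \<times> {0<..}. G p C \<epsilon>)"
    proof (rule cINF_greatest)
      show "({0<..} \<times> {0<..} :: (real \<times> real) set) \<noteq> {}" by (auto intro: gt_ex)
      fix z :: "real \<times> real" assume "z \<in> {0<..} \<times> {0<..}"
      then obtain C \<epsilon> where z: "z = (C, \<epsilon>)" "0 < C" "0 < \<epsilon>" by auto
      have "ennreal (enn2real (I p)) \<le> ennreal (G p C \<epsilon> powr p)"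
        using I_le[OF p z(2,3)] fin by simp
      then have "enn2real (I p) \<le> G p C \<epsilon> powr p" by simp
      then have "enn2real (I p) powr (1 / p) \<le> (G p C \<epsilon> powr p) powr (1 / p)"
        using p by (intro powr_mono2) auto
      also have "\<dots> = G p C \<epsilon>" using p G_nonneg[OF z(2)] by (simp add: powr_powr)
      finally show "enn2real (I p) powr (1 / p) \<le> (case z of (C, \<epsilon>) \<Rightarrow> G p C \<epsilon>)"
        by (simp add: z)
    qed
    then show ?thesis using fin(2) by (simp add: ennreal_powr_def ennreal_leI)
  qed

  have bound2: "(INF (C, \<epsilon>)\<in>{0<..} \<times> {0<..}. G p C \<epsilon>) \<le> (INF C\<in>{0<..}. H p C)" for p
  proof (rule cINF_greatest)
    show "({0<..} :: real set) \<noteq> {}" by (auto intro: gt_ex)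
    fix C :: real assume "C \<in> {0<..}"
    then have C: "0 < C" by simp
    define a where "a = 2 * sqrt (real M) * L * (\<beta> - \<alpha>) * inverse (C * b)"
    have a: "0 < a" using C b M L \<alpha>\<beta> by (simp add: a_def)
    \<comment> \<open>The argument of the logarithm is the square of the base \<open>a\<close>,
      which matches the form in \<open>ex_exponent_le\<close>.\<close>
    have a2: "4 * real M * L\<^sup>2 * (\<beta> - \<alpha>)\<^sup>2 * (inverse (C * b))\<^sup>2 = a\<^sup>2"
      by (simp add: a_def power_mult_distrib)
    obtain \<epsilon> where \<epsilon>: "0 < \<epsilon>" "max 1 (a powr \<epsilon>) * sqrt (Max {1, p, real CARD('k) / \<epsilon>})
        \<le> sqrt (exp 1 * Max {1, p, real CARD('k) * ln (a\<^sup>2)})"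
      using ex_exponent_le[OF a, of "real CARD('k)" p] by auto
    \<comment> \<open>A real infimum is known to lie below the members of the family only once the
      family is bounded below, here by 0.\<close>
    have "bdd_below ((\<lambda>(C, \<epsilon>). G p C \<epsilon>) ` ({0<..} \<times> {0<..}))"
      using G_nonneg by (intro bdd_belowI[of _ 0]) auto
    then have "(INF (C, \<epsilon>)\<in>{0<..} \<times> {0<..}. G p C \<epsilon>) \<le> G p C \<epsilon>"
      using cINF_lower[of "\<lambda>(C, \<epsilon>). G p C \<epsilon>" "{0<..} \<times> {0<..}" "(C, \<epsilon>)"] C \<epsilon>(1) by simp
    also have "\<dots> = 2 * (C + 1) * b\<^sup>2 * (max 1 (a powr \<epsilon>) * sqrt (Max {1, p, real CARD('k) / \<epsilon>}))
        / sqrt (real M)"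
      by (simp only: G_def a_def mult.assoc)
    also have "\<dots> \<le> H p C"
      unfolding H_def a2 using C by (intro divide_right_mono mult_left_mono \<epsilon>(2)) auto
    finally show "(INF (C, \<epsilon>)\<in>{0<..} \<times> {0<..}. G p C \<epsilon>) \<le> H p C" .
  qed

  show ?thesis
    using measurable_SUP bound1 bound2 unfolding \<Delta>_def G_def H_def I_def by blast
qed

end
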